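(* Consider the following identities for bounded $\lambda$-lattices $(L,\sqcup,\sqcap,{}',0,1)$ with a unary operation: (1) $(x\sqcup y)\sqcup(x'\sqcup y)\approx 1$; (2) $(x\sqcap y)\sqcap(x'\sqcap y)\approx 0$; (3) $(((x\sqcap y')\sqcup z)\sqcup(y\sqcup z))\sqcap((x\sqcap y')\sqcup y)\approx(x\sqcap y')\sqcup y$; (4) $(((x\sqcap y)'\sqcap z)\sqcap(y\sqcap z))\sqcup((x\sqcap y)'\sqcap y)\approx(x\sqcap y)'\sqcap y$; (5) $x\sqcup(x'\sqcap(x\sqcup y))\approx x\sqcup y$. Then: (i) identities (1)–(4) are independent, i.e. for each $i\in\{1,2,3,4\}$ there is a bounded $\lambda$-lattice with a unary operation that satisfies the three identities among (1)–(4) other than $(i)$ but does not satisfy $(i)$; (ii) identities (1)–(4) do not imply identity (5), i.e. there is a bounded $\lambda$-lattice with a unary operation that satisfies (1)–(4) but not (5).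
   Context: A bounded $\lambda$-lattice is an algebra $(L,\sqcup,\sqcap,0,1)$ of type $(2,2,0,0)$ satisfying the identities $x\sqcup y\approx y\sqcup x$, $x\sqcap y\approx y\sqcap x$, $x\sqcup((x\sqcup y)\sqcup z)\approx(x\sqcup y)\sqcup z$, $x\sqcap((x\sqcap y)\sqcap z)\approx(x\sqcap y)\sqcap z$, $x\sqcup(x\sqcap y)\approx x$, $x\sqcap(x\sqcup y)\approx x$, $x\sqcup0\approx x$, $x\sqcup1\approx1$. A bounded $\lambda$-lattice with a unary operation is an algebra $(L,\sqcup,\sqcap,{}',0,1)$ such that $(L,\sqcup,\sqcap,0,1)$ is a bounded $\lambda$-lattice and ${}'$ is an arbitrary unary operation on $L$. *)

theory Defs
  imports Main
begin

record 'a bounded_lattice_alg =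
  carrier :: "'a set"
  join :: "'a \<Rightarrow> 'a \<Rightarrow> 'a"  (infixl "\<squnion>\<index>" 65)
  meet :: "'a \<Rightarrow> 'a \<Rightarrow> 'a"  (infixl "\<sqinter>\<index>" 70)
  zero :: 'a  ("\<zero>\<index>")
  one :: 'a  ("\<one>\<index>")

record 'a unary_bounded_lattice_alg = "'a bounded_lattice_alg" +
  prime_op :: "'a \<Rightarrow> 'a"  ("_\<acute>\<index>" [1000] 999)

locale bounded_lambda_lattice =
  fixes L :: "('a, 'b) bounded_lattice_alg_scheme"  (structure)
  assumes join_closed: "\<lbrakk>x \<in> carrier L; y \<in> carrier L\<rbrakk> \<Longrightarrow> x \<squnion> y \<in> carrier L"
    and meet_closed: "\<lbrakk>x \<in> carrier L; y \<in> carrier L\<rbrakk> \<Longrightarrow> x \<sqinter> y \<in> carrier L"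
    and zero_closed: "\<zero> \<in> carrier L"
    and one_closed: "\<one> \<in> carrier L"
    and join_comm: "\<lbrakk>x \<in> carrier L; y \<in> carrier L\<rbrakk> \<Longrightarrow> x \<squnion> y = y \<squnion> x"
    and meet_comm: "\<lbrakk>x \<in> carrier L; y \<in> carrier L\<rbrakk> \<Longrightarrow> x \<sqinter> y = y \<sqinter> x"
    and join_skew_assoc:
      "\<lbrakk>x \<in> carrier L; y \<in> carrier L; z \<in> carrier L\<rbrakk> \<Longrightarrow> x \<squnion> ((x \<squnion> y) \<squnion> z) = (x \<squnion> y) \<squnion> z"
    and meet_skew_assoc:
      "\<lbrakk>x \<in> carrier L; y \<in> carrier L; z \<in> carrier L\<rbrakk> \<Longrightarrow> x \<sqinter> ((x \<sqinter> y) \<sqinter> z) = (x \<sqinter> y) \<sqinter> z"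
    and join_absorb: "\<lbrakk>x \<in> carrier L; y \<in> carrier L\<rbrakk> \<Longrightarrow> x \<squnion> (x \<sqinter> y) = x"
    and meet_absorb: "\<lbrakk>x \<in> carrier L; y \<in> carrier L\<rbrakk> \<Longrightarrow> x \<sqinter> (x \<squnion> y) = x"
    and join_zero: "x \<in> carrier L \<Longrightarrow> x \<squnion> \<zero> = x"
    and join_one: "x \<in> carrier L \<Longrightarrow> x \<squnion> \<one> = \<one>"

locale unary_bounded_lambda_lattice = bounded_lambda_lattice L
  for L :: "('a, 'b) unary_bounded_lattice_alg_scheme"  (structure) +
  assumes prime_closed: "x \<in> carrier L \<Longrightarrow> x\<acute> \<in> carrier L"

datatype identity_label = Id1 | Id2 | Id3 | Id4 | Id5

context
  fixes L :: "('a, 'b) unary_bounded_lattice_alg_scheme"  (structure)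
begin

primrec satisfies_identity :: "identity_label \<Rightarrow> bool" where
  "satisfies_identity Id1 \<longleftrightarrow>
    (\<forall>x \<in> carrier L. \<forall>y \<in> carrier L. (x \<squnion> y) \<squnion> (x\<acute> \<squnion> y) = \<one>)"
| "satisfies_identity Id2 \<longleftrightarrow>
    (\<forall>x \<in> carrier L. \<forall>y \<in> carrier L. (x \<sqinter> y) \<sqinter> (x\<acute> \<sqinter> y) = \<zero>)"
| "satisfies_identity Id3 \<longleftrightarrow>
    (\<forall>x \<in> carrier L. \<forall>y \<in> carrier L. \<forall>z \<in> carrier L.
      (((x \<sqinter> y\<acute>) \<squnion> z) \<squnion> (y \<squnion> z)) \<sqinter> ((x \<sqinter> y\<acute>) \<squnion> y) = (x \<sqinter> y\<acute>) \<squnion> y)"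
| "satisfies_identity Id4 \<longleftrightarrow>
    (\<forall>x \<in> carrier L. \<forall>y \<in> carrier L. \<forall>z \<in> carrier L.
      (((x \<sqinter> y)\<acute> \<sqinter> z) \<sqinter> (y \<sqinter> z)) \<squnion> ((x \<sqinter> y)\<acute> \<sqinter> y) = (x \<sqinter> y)\<acute> \<sqinter> y)"
| "satisfies_identity Id5 \<longleftrightarrow>
    (\<forall>x \<in> carrier L. \<forall>y \<in> carrier L. x \<squnion> (x\<acute> \<sqinter> (x \<squnion> y)) = x \<squnion> y)"

end

end

theory Submission
  imports Defs
begin

text \<open>
  A \<open>\<lambda>\<close>-lattice is a bounded poset together with a choice of an upper and a lower bound for every
  pair of incomparable elements. In a genuine lattice (3) and (4) hold trivially and (1), (2) say
  that \<open>x'\<close> is a complement of \<open>x\<close>. Hence the two-element chain with a constant unary operation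
  separates (1) and (2), and the pentagon with a complementation that is not orthomodular
  separates (5). Identities (3) and (4) are separated by two seven-element \<open>\<lambda>\<close>-lattices in which
  some join, respectively meet, of incomparable elements is not their supremum, respectively
  infimum.
\<close>

definition table_alg :: "nat list list \<Rightarrow> nat list list \<Rightarrow> nat list \<Rightarrow> nat unary_bounded_lattice_alg"
  where "table_alg J M P =
    \<lparr>carrier = {..<length P}, join = (\<lambda>x y. J ! x ! y), meet = (\<lambda>x y. M ! x ! y),
     zero = 0, one = length P - 1, prime_op = (\<lambda>x. P ! x)\<rparr>"

lemma table_alg_simps [simp, code]:
  "carrier (table_alg J M P) = {..<length P}"
  "join (table_alg J M P) x y = J ! x ! y"
  "meet (table_alg J M P) x y = M ! x ! y"
  "zero (table_alg J M P) = 0"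
  "one (table_alg J M P) = length P - 1"
  "prime_op (table_alg J M P) x = P ! x"
  by (simp_all add: table_alg_def)

text \<open>The locale axioms with all quantifiers over a finite range, so that
  \<open>code_simp\<close> can decide them for explicit tables.\<close>

definition lambda_lattice_tables :: "nat list list \<Rightarrow> nat list list \<Rightarrow> nat list \<Rightarrow> bool"
  where "lambda_lattice_tables J M P \<longleftrightarrow>
    0 < length P \<and>
    (\<forall>x\<in>{..<length P}.
      P ! x < length P \<and> J ! x ! 0 = x \<and> J ! x ! (length P - 1) = length P - 1 \<and>
      (\<forall>y\<in>{..<length P}.
        J ! x ! y < length P \<and> M ! x ! y < length P \<and>
        J ! x ! y = J ! y ! x \<and> M ! x ! y = M ! y ! x \<and>
        J ! x ! (M ! x ! y) = x \<and> M ! x ! (J ! x ! y) = x \<and>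
        (\<forall>z\<in>{..<length P}.
          J ! x ! (J ! (J ! x ! y) ! z) = J ! (J ! x ! y) ! z \<and>
          M ! x ! (M ! (M ! x ! y) ! z) = M ! (M ! x ! y) ! z)))"

lemma unary_bounded_lambda_lattice_table_alg:
  assumes "lambda_lattice_tables J M P"
  shows "unary_bounded_lambda_lattice (table_alg J M P)"
  using assms unfolding lambda_lattice_tables_def Ball_def lessThan_iff
  by unfold_locales
    (unfold table_alg_simps lessThan_iff, (blast intro: diff_less zero_less_one)+)

abbreviation satisfies_except ::
    "(nat list list \<Rightarrow> nat list list \<Rightarrow> nat list \<Rightarrow> identity_label \<Rightarrow> bool)"
  where "satisfies_except J M P i \<equiv>
    lambda_lattice_tables J M P \<and>
    (\<forall>j\<in>{Id1, Id2, Id3, Id4} - {i}. satisfies_identity (table_alg J M P) j) \<and>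
    \<not> satisfies_identity (table_alg J M P) i"

lemma id1_independent:
  "satisfies_except [[0, 1], [1, 1]] [[0, 0], [0, 1]] [0, 0] Id1"
  by code_simp

lemma id2_independent:
  "satisfies_except [[0, 1], [1, 1]] [[0, 0], [0, 1]] [1, 1] Id2"
  by code_simp

text \<open>The join of 1 and 3 is 6 although 4 bounds both; (3) fails at \<open>x = 3\<close>,
  \<open>y = 1\<close>, \<open>z = 4\<close>.\<close>

lemma id3_independent:
  "satisfies_except
    [[0, 1, 2, 3, 4, 5, 6],
     [1, 1, 6, 6, 4, 6, 6],
     [2, 6, 2, 6, 6, 6, 6],
     [3, 6, 6, 3, 4, 5, 6],
     [4, 4, 6, 4, 4, 6, 6],
     [5, 6, 6, 5, 6, 5, 6],
     [6, 6, 6, 6, 6, 6, 6]]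
    [[0, 0, 0, 0, 0, 0, 0],
     [0, 1, 0, 0, 1, 0, 1],
     [0, 0, 2, 0, 0, 0, 2],
     [0, 0, 0, 3, 3, 3, 3],
     [0, 1, 0, 3, 4, 3, 4],
     [0, 0, 0, 3, 3, 5, 5],
     [0, 1, 2, 3, 4, 5, 6]]
    [6, 5, 1, 2, 2, 1, 0] Id3"
  by code_simp

text \<open>The meet of 3 and 5 is 0 although 2 lies below both; (4) fails at \<open>x = 1\<close>,
  \<open>y = 3\<close>, \<open>z = 2\<close>.\<close>

lemma id4_independent:
  "satisfies_except
    [[0, 1, 2, 3, 4, 5, 6],
     [1, 1, 3, 3, 6, 6, 6],
     [2, 3, 2, 3, 6, 5, 6],
     [3, 3, 3, 3, 6, 6, 6],
     [4, 6, 6, 6, 4, 6, 6],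
     [5, 6, 5, 6, 6, 5, 6],
     [6, 6, 6, 6, 6, 6, 6]]
    [[0, 0, 0, 0, 0, 0, 0],
     [0, 1, 0, 1, 0, 0, 1],
     [0, 0, 2, 2, 0, 2, 2],
     [0, 1, 2, 3, 0, 0, 3],
     [0, 0, 0, 0, 4, 0, 4],
     [0, 0, 2, 0, 0, 5, 5],
     [0, 1, 2, 3, 4, 5, 6]]
    [6, 5, 4, 4, 1, 1, 0] Id4"
  by code_simp

text \<open>The pentagon \<open>0 < 1 < 2 < 4\<close>, \<open>0 < 3 < 4\<close>; identity (5) fails at \<open>x = 1\<close>, \<open>y = 2\<close>.\<close>

lemma id5_independent:
  "satisfies_except
    [[0, 1, 2, 3, 4],
     [1, 1, 2, 4, 4],
     [2, 2, 2, 4, 4],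
     [3, 4, 4, 3, 4],
     [4, 4, 4, 4, 4]]
    [[0, 0, 0, 0, 0],
     [0, 1, 1, 0, 1],
     [0, 1, 2, 0, 2],
     [0, 0, 0, 3, 3],
     [0, 1, 2, 3, 4]]
    [4, 3, 3, 1, 0] Id5"
  by code_simp

theorem theorem10:
  shows "(\<forall>i \<in> {Id1, Id2, Id3, Id4}.
            \<exists>L :: nat unary_bounded_lattice_alg.
              unary_bounded_lambda_lattice L \<and>
              (\<forall>j \<in> {Id1, Id2, Id3, Id4} - {i}. satisfies_identity L j) \<and>
              \<not> satisfies_identity L i)
       \<and> (\<exists>L :: nat unary_bounded_lattice_alg.
            unary_bounded_lambda_lattice L \<and>
            (\<forall>j \<in> {Id1, Id2, Id3, Id4}. satisfies_identity L j) \<and>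
            \<not> satisfies_identity L Id5)"
proof -
  have model: "\<exists>L :: nat unary_bounded_lattice_alg.
      unary_bounded_lambda_lattice L \<and>
      (\<forall>j \<in> {Id1, Id2, Id3, Id4} - {i}. satisfies_identity L j) \<and> \<not> satisfies_identity L i"
    if "satisfies_except J M P i" for J M P i
    using that unary_bounded_lambda_lattice_table_alg by blast
  \<comment> \<open>Taking \<open>i = Id5\<close> removes none of the four labels, so
    \<open>model\<close> yields (ii) as well as (i).\<close>
  have "{Id1, Id2, Id3, Id4} - {Id5} = {Id1, Id2, Id3, Id4}"
    by simp
  with model [OF id1_independent] model [OF id2_independent] model [OF id3_independent]
    model [OF id4_independent] model [OF id5_independent]
  show ?thesis
    by (metis (no_types, lifting) empty_iff insert_iff)
qed

end
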